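(* For every integer $n \geq 4$ there exists an algorithm solving the priority evacuation problem $PE_n$ (one queen and $n$ servants) whose evacuation time is at most $2 + 4(\sqrt{2}-1)\frac{\pi}{n}$.
   Context: Priority evacuation problem $PE_n$: $n+1$ mobile robots, one distinguished robot called the queen and $n$ robots called servants, all start at time $0$ at the center $O=(0,0)$ of the unit disk. Each robot moves with speed at most $1$. An exit is located at an unknown point of the unit circle $\mathcal{U}$ (the boundary of the disk); a robot discovers the exit when it walks over its location, and immediately and instantaneously broadcasts its position to all robots (wireless communication). An algorithm specifies the trajectories of all robots as functions of time for as long as the exit has not been found; once the exit is found, the queen moves to it. An algorithm solves $PE_n$ if, in finite time, every point of $\mathcal{U}$ is visited by at least one robot. The evacuation time of an algorithm is the worst case, over all possible exit positions on $\mathcal{U}$, of the time at which the queen reaches the exit. The queen may or may not participate in the search. *)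

theory Defs
  imports "HOL-Analysis.Analysis" "HOL-Library.Extended_Real"
begin

text \<open>
  The plane is identified with \<^typ>\<open>complex\<close>, so the centre of the disk is \<open>0\<close> and the unit circle
  is \<open>sphere 0 1\<close>. An algorithm assigns to every robot its trajectory, as a function of time
  \<open>t \<ge> 0\<close>, that it follows as long as the exit has not been found.
\<close>

datatype robot = Queen | Servant nat

definition robots :: "nat \<Rightarrow> robot set" where
  "robots n = insert Queen (Servant ` {1..n})"

type_synonym algorithm = "robot \<Rightarrow> real \<Rightarrow> complex"

text \<open>Speed at most \<open>1\<close> is rendered as \<open>1\<close>-Lipschitz continuity in time.\<close>

definition valid_algorithm :: "nat \<Rightarrow> algorithm \<Rightarrow> bool" where
  "valid_algorithm n A \<longleftrightarrow> (\<forall>r\<in>robots n. A r 0 = 0 \<and> 1-lipschitz_on {0..} (A r))"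

definition solves_PE :: "nat \<Rightarrow> algorithm \<Rightarrow> bool" where
  "solves_PE n A \<longleftrightarrow> valid_algorithm n A \<and>
     (\<exists>T\<ge>0. \<forall>x\<in>sphere 0 1. \<exists>r\<in>robots n. \<exists>t\<in>{0..T}. A r t = x)"

text \<open>
  The infimum is only meaningful (and is then attained, trajectories being continuous) if \<open>x\<close> is
  visited by some robot, which \<open>solves_PE\<close> guarantees for all points of the circle.
\<close>

definition discovery_time :: "nat \<Rightarrow> algorithm \<Rightarrow> complex \<Rightarrow> real" where
  "discovery_time n A x = Inf {t. 0 \<le> t \<and> (\<exists>r\<in>robots n. A r t = x)}"

text \<open>
  At the discovery time the queen leaves her trajectory and moves to the exit along a straight line
  at unit speed.
\<close>

definition queen_arrival_time :: "nat \<Rightarrow> algorithm \<Rightarrow> complex \<Rightarrow> real" where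
  "queen_arrival_time n A x =
     discovery_time n A x + dist (A Queen (discovery_time n A x)) x"

text \<open>The supremum is taken in \<^typ>\<open>ereal\<close>, so that it is the true one without a boundedness proof.\<close>

definition evacuation_time :: "nat \<Rightarrow> algorithm \<Rightarrow> ereal" where
  "evacuation_time n A = (SUP x\<in>sphere 0 1. ereal (queen_arrival_time n A x))"

end

theory Submission
  imports Defs
begin

text \<open>
  The queen waits at the centre until time \<open>1 + w\<close> and then walks along the positive real axis.
  She reaches an exit at \<open>cis s\<close> by time \<open>2 + sqrt 2 * w\<close> iff it is found by time
  \<open>1 + deadline w s\<close>. To first order in \<open>w\<close>, the deadline is
  \<open>w * (sqrt 2 - cos s) / (1 - cos s)\<close>, so one servant can search about that length of circle
  near \<open>cis s\<close>. The reciprocal, up to the factor \<open>w\<close>, has the elementary antiderivative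
  \<open>sweep\<close>, because \<open>1 / (sqrt 2 - cos s)\<close> is a multiple of a Poisson kernel; \<open>w\<close> is the
  \<open>n\<close>-th part of the increase of \<open>sweep\<close> around the circle.

  The circle is cut into \<open>n\<close> arcs along which \<open>sweep\<close> increases by \<open>w\<close>, and each servant
  searches its arc from the end nearer to \<open>-1\<close> (early deadlines) to the end nearer to \<open>1\<close>
  (late deadlines). The length searched by a servant is then compared with the deadline where it
  is, rather than with the average over the arc; this gain outweighs the loss from the first-order
  approximation.
\<close>

subsection \<open>Elementary inequalities\<close>

lemma sqrt2_bounds: "7 / 5 \<le> sqrt 2" "sqrt 2 \<le> 10 / 7"
  by (rule real_le_rsqrt real_le_lsqrt; simp add: power2_eq_square)+

lemma one_minus_cos_eq: "1 - cos s = 2 * (sin (s / 2))\<^sup>2" for s :: real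
  using cos_double_sin[of "s / 2"] by simp

lemma one_minus_cos_le: "1 - cos s \<le> s\<^sup>2 / 2" for s :: real
proof -
  have "(sin (s / 2))\<^sup>2 \<le> (s / 2)\<^sup>2"
    using abs_sin_x_le_abs_x[of "s / 2"] by (simp only: abs_le_square_iff)
  then show ?thesis unfolding one_minus_cos_eq by (simp add: power_divide)
qed

lemma sin_squared_mult_tan: "cos x \<noteq> 0 \<Longrightarrow> (sin x)\<^sup>2 * (1 + (tan x)\<^sup>2) = (tan x)\<^sup>2"
  for x :: "'a :: {real_normed_field, banach}"
  by (subst tan_sec) (simp_all add: tan_def field_simps)

lemma sin_squared_le_tan_squared: "cos x \<noteq> 0 \<Longrightarrow> (sin x)\<^sup>2 \<le> (tan x)\<^sup>2" for x :: real
  using mult_left_mono[of 1 "1 + (tan x)\<^sup>2" "(sin x)\<^sup>2"] sin_squared_mult_tan[of x] by simp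

lemma sin_le_Taylor_5:
  fixes x :: real
  assumes "0 \<le> x"
  shows "sin x \<le> x - x ^ 3 / 6 + x ^ 5 / 120"
proof -
  have "{..<5::nat} = {0, 1, 2, 3, 4}" by auto
  then have "(\<Sum>m<5. sin_coeff m * x ^ m) = x - x ^ 3 / 6"
    by (simp add: sin_coeff_def fact_numeral)
  moreover have "inverse (fact 5 :: real) * \<bar>x\<bar> ^ 5 = x ^ 5 / 120"
    using assms by (simp add: fact_numeral)
  ultimately have "\<bar>sin x - (x - x ^ 3 / 6)\<bar> \<le> x ^ 5 / 120"
    using Maclaurin_sin_bound[of x 5] by simp
  then show ?thesis by linarith
qed

lemma cube_le_minus_sin:
  fixes x :: real
  assumes "0 \<le> x" "x \<le> 2"
  shows "x ^ 3 / 8 \<le> x - sin x"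
proof -
  have "x\<^sup>2 \<le> 2\<^sup>2" using assms by (intro power_mono)
  then have "x ^ 5 \<le> 4 * x ^ 3"
    using mult_right_mono[of "x\<^sup>2" 4 "x ^ 3"] assms by (simp flip: power_add)
  moreover have "0 \<le> x ^ 3" using assms by simp
  ultimately show ?thesis using sin_le_Taylor_5[OF assms(1)] by linarith
qed

lemma minus_sin_cos_le:
  fixes x :: real
  assumes "0 \<le> x" "x < pi / 2"
  shows "x - sin x * cos x \<le> 2 / 3 * ((sin x)\<^sup>2 * tan x)"
proof -
  define f :: "real \<Rightarrow> real"
    where "f t = 2 / 3 * ((sin t)\<^sup>2 * tan t) - (t - sin t * cos t)" for t
  have "f 0 \<le> f x"
  proof (rule DERIV_nonneg_imp_nondecreasing[OF assms(1)])
    fix t assume "0 \<le> t" "t \<le> x"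
    then have "cos t \<noteq> 0" using assms cos_gt_zero_pi[of t] by simp
    have "(f has_real_derivative
        2 / 3 * (2 * sin t * cos t * tan t + (sin t)\<^sup>2 * inverse ((cos t)\<^sup>2))
          - (1 - (cos t * cos t - sin t * sin t))) (at t)"
      unfolding f_def using \<open>cos t \<noteq> 0\<close> by (auto intro!: derivative_eq_intros)
    moreover have "2 * sin t * cos t * tan t + (sin t)\<^sup>2 * inverse ((cos t)\<^sup>2)
        = 2 * (sin t)\<^sup>2 + (tan t)\<^sup>2"
      using \<open>cos t \<noteq> 0\<close> by (simp add: tan_def power2_eq_square field_simps)
    moreover have "1 - (cos t * cos t - sin t * sin t) = 2 * (sin t)\<^sup>2"
      using sin_cos_squared_add[of t] by (simp add: power2_eq_square)
    ultimately have "(f has_real_derivative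
        2 / 3 * (2 * (sin t)\<^sup>2 + (tan t)\<^sup>2) - 2 * (sin t)\<^sup>2) (at t)"
      by (simp only:)
    moreover have "0 \<le> 2 / 3 * (2 * (sin t)\<^sup>2 + (tan t)\<^sup>2) - 2 * (sin t)\<^sup>2"
      using sin_squared_le_tan_squared[OF \<open>cos t \<noteq> 0\<close>] by simp
    ultimately show "\<exists>y. (f has_real_derivative y) (at t) \<and> 0 \<le> y" by blast
  qed
  then show ?thesis by (simp add: f_def)
qed

lemma le_one_minus_cos_plus_sin:
  fixes x :: real
  assumes "0 \<le> x" "x \<le> pi / 2"
  shows "x \<le> 1 - cos x + sin x"
proof -
  define f :: "real \<Rightarrow> real" where "f t = 1 - cos t + sin t - t" for t
  have "f 0 \<le> f x"
  proof (rule DERIV_nonneg_imp_nondecreasing[OF assms(1)])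
    fix t assume "0 \<le> t" "t \<le> x"
    then have "0 \<le> sin t" "0 \<le> cos t"
      using assms by (auto intro!: sin_ge_zero cos_ge_zero)
    then have "(sin t)\<^sup>2 \<le> sin t" "(cos t)\<^sup>2 \<le> cos t"
      by (simp_all add: power2_eq_square mult_left_le)
    then have "0 \<le> sin t + cos t - 1" using sin_cos_squared_add[of t] by linarith
    moreover have "(f has_real_derivative sin t + cos t - 1) (at t)"
      unfolding f_def by (auto intro!: derivative_eq_intros)
    ultimately show "\<exists>y. (f has_real_derivative y) (at t) \<and> 0 \<le> y" by blast
  qed
  then show ?thesis by (simp add: f_def)
qed

lemma cos_add_le:
  fixes \<alpha> x :: real
  assumes "0 \<le> \<alpha>" "\<alpha> < pi / 2" "0 \<le> x" "x \<le> pi / 2"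
  shows "cos (\<alpha> + x) \<le> (1 - min (tan \<alpha>) 1 * x) * cos \<alpha>"
proof -
  have "0 < cos \<alpha>" using assms by (intro cos_gt_zero_pi) auto
  have "0 \<le> tan \<alpha>" using assms by (intro tan_pos_pi2_le)
  have "min (tan \<alpha>) 1 * x \<le> min (tan \<alpha>) 1 * (1 - cos x + sin x)"
    using le_one_minus_cos_plus_sin[of x] assms \<open>0 \<le> tan \<alpha>\<close> by (intro mult_left_mono) auto
  also have "\<dots> \<le> 1 * (1 - cos x) + tan \<alpha> * sin x"
    unfolding distrib_left using assms by (intro add_mono mult_right_mono sin_ge_zero) auto
  finally have "cos x - tan \<alpha> * sin x \<le> 1 - min (tan \<alpha>) 1 * x" by simp
  moreover have "cos (\<alpha> + x) = (cos x - tan \<alpha> * sin x) * cos \<alpha>"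
    using \<open>0 < cos \<alpha>\<close> by (simp add: cos_add tan_def algebra_simps)
  ultimately show ?thesis using \<open>0 < cos \<alpha>\<close> by (simp add: mult_right_mono)
qed

lemma cos_diff_le_abs: "cos x - cos y \<le> \<bar>x - y\<bar>" for x y :: real
proof -
  have "\<bar>cos x - cos y\<bar> = 2 * \<bar>sin ((x + y) / 2)\<bar> * \<bar>sin ((y - x) / 2)\<bar>"
    by (simp add: cos_diff_cos abs_mult)
  also have "\<dots> \<le> 2 * 1 * \<bar>(y - x) / 2\<bar>"
    by (intro mult_mono abs_sin_x_le_abs_x) auto
  finally show ?thesis by simp
qed

lemma DERIV_arctan_Poisson:
  fixes r s :: real
  assumes "\<bar>r\<bar> < 1"
  shows "((\<lambda>s. s + 2 * arctan (r * sin s / (1 - r * cos s))) has_real_derivative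
    (1 - r\<^sup>2) / (1 - 2 * r * cos s + r\<^sup>2)) (at s)"
proof -
  define m where "m = 1 - r * cos s"
  define d where "d = 1 - 2 * r * cos s + r\<^sup>2"
  have "\<bar>r * cos s\<bar> \<le> \<bar>r\<bar> * 1" unfolding abs_mult by (intro mult_left_mono) auto
  then have "0 < m" using assms unfolding m_def by linarith
  have d_eq: "m\<^sup>2 + (r * sin s)\<^sup>2 = d"
    unfolding m_def d_def power_mult_distrib sin_squared_eq
    by (simp add: power2_eq_square algebra_simps)
  then have "0 < d" using \<open>0 < m\<close> by (metis add_pos_nonneg zero_less_power zero_le_power2)
  have "((\<lambda>s. s + 2 * arctan (r * sin s / (1 - r * cos s))) has_real_derivative
      1 + 2 * (inverse (1 + (r * sin s / m)\<^sup>2)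
        * ((r * cos s * m - r * sin s * (r * sin s)) / (m * m)))) (at s)"
    using \<open>0 < m\<close> unfolding m_def by (auto intro!: derivative_eq_intros)
  moreover have "inverse (1 + (r * sin s / m)\<^sup>2) = m\<^sup>2 / d"
    using \<open>0 < m\<close> unfolding d_eq[symmetric] by (simp add: field_simps)
  moreover have "r * cos s * m - r * sin s * (r * sin s) = r * cos s - r\<^sup>2"
    using sin_cos_squared_add3[of s] unfolding m_def by algebra
  ultimately have "((\<lambda>s. s + 2 * arctan (r * sin s / (1 - r * cos s))) has_real_derivative
      1 + 2 * (m\<^sup>2 / d * ((r * cos s - r\<^sup>2) / (m * m)))) (at s)" by simp
  moreover have "1 + 2 * (m\<^sup>2 / d * ((r * cos s - r\<^sup>2) / (m * m)))
      = (d + 2 * (r * cos s - r\<^sup>2)) / d"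
    using \<open>0 < m\<close> \<open>0 < d\<close> by (simp add: power2_eq_square add_divide_distrib)
  moreover have "d + 2 * (r * cos s - r\<^sup>2) = 1 - r\<^sup>2" by (simp add: d_def)
  ultimately show ?thesis by (simp add: d_def)
qed

subsection \<open>Search capacity along the circle\<close>

definition lag :: "real \<Rightarrow> real" where
  "lag s = (sqrt 2 - 1) * (s + 2 * arctan ((sqrt 2 - 1) * sin s / (1 - (sqrt 2 - 1) * cos s)))"

definition sweep :: "real \<Rightarrow> real" where
  "sweep s = s - lag s"

definition lag' :: "real \<Rightarrow> real" where
  "lag' s = (sqrt 2 - 1) / (sqrt 2 - cos s)"

definition sweep' :: "real \<Rightarrow> real" where
  "sweep' s = (1 - cos s) / (sqrt 2 - cos s)"

lemma sqrt2_minus_cos_pos: "0 < sqrt 2 - cos s"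
  using sqrt2_bounds cos_le_one[of s] by linarith

lemma sweep'_eq: "sweep' s = 1 - lag' s"
  using sqrt2_minus_cos_pos[of s] by (simp add: sweep'_def lag'_def field_simps)

lemma sweep'_lag': "(sqrt 2 - 1) * sweep' s = (1 - cos s) * lag' s"
  by (simp add: sweep'_def lag'_def)

lemma sweep'_nonneg: "0 \<le> sweep' s"
  using sqrt2_minus_cos_pos[of s] by (simp add: sweep'_def)

lemma lag'_pos: "0 < lag' s"
  using sqrt2_minus_cos_pos[of s] by (simp add: lag'_def)

lemma DERIV_lag: "(lag has_real_derivative lag' s) (at s)"
proof -
  define r :: real where "r = sqrt 2 - 1"
  have r_sq: "r\<^sup>2 = 1 - 2 * r" by (simp add: r_def power2_eq_square algebra_simps)
  have "0 < r" "r < 1" using sqrt2_bounds by (simp_all add: r_def)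
  have "1 - 2 * r * cos s + r\<^sup>2 = 2 * r * (sqrt 2 - cos s)"
    unfolding r_sq by (simp add: r_def algebra_simps)
  then have "r * ((1 - r\<^sup>2) / (1 - 2 * r * cos s + r\<^sup>2)) = lag' s"
    using \<open>0 < r\<close> r_sq by (simp add: lag'_def r_def[symmetric])
  moreover have "(lag has_real_derivative r * ((1 - r\<^sup>2) / (1 - 2 * r * cos s + r\<^sup>2))) (at s)"
    unfolding lag_def r_def[symmetric]
    using \<open>0 < r\<close> \<open>r < 1\<close> by (intro DERIV_cmult DERIV_arctan_Poisson) simp
  ultimately show ?thesis by simp
qed

lemma DERIV_sweep: "(sweep has_real_derivative sweep' s) (at s)"
  unfolding sweep_def sweep'_eq by (intro DERIV_diff DERIV_ident DERIV_lag)

lemmas [derivative_intros] = DERIV_lag[THEN DERIV_chain2] DERIV_sweep[THEN DERIV_chain2]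

lemma lag_0 [simp]: "lag 0 = 0" and lag_pi: "lag pi = (sqrt 2 - 1) * pi"
  by (simp_all add: lag_def)

lemma sweep_0 [simp]: "sweep 0 = 0" and sweep_pi: "sweep pi = (2 - sqrt 2) * pi"
  by (simp_all add: sweep_def lag_pi algebra_simps)

lemma sweep_pi_le_2: "sweep pi \<le> 2"
proof -
  have "(2 - sqrt 2) * pi \<le> 3 / 5 * 3.2"
    using sqrt2_bounds pi_approx by (intro mult_mono) auto
  then show ?thesis by (simp add: sweep_pi)
qed

lemma sweep_reflect: "sweep (2 * pi - s) = 2 * sweep pi - sweep s"
proof -
  have "lag (2 * pi - s) = 2 * lag pi - lag s"
    unfolding lag_def by (simp add: sin_diff cos_diff arctan_minus) (simp add: algebra_simps)
  then show ?thesis by (simp add: sweep_def)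
qed

lemma lag_mono: "s \<le> t \<Longrightarrow> lag s \<le> lag t"
  by (erule DERIV_nonneg_imp_nondecreasing) (use DERIV_lag lag'_pos less_imp_le in blast)

lemma sweep_mono: "s \<le> t \<Longrightarrow> sweep s \<le> sweep t"
  by (erule DERIV_nonneg_imp_nondecreasing) (use DERIV_sweep sweep'_nonneg in blast)

lemma continuous_on_sweep: "continuous_on S sweep"
  using DERIV_sweep by (intro continuous_at_imp_continuous_on) (blast intro: DERIV_isCont)

lemma strict_mono_on_sweep: "strict_mono_on {0..2 * pi} sweep"
proof (rule strict_mono_onI)
  fix s t :: real
  assume "s \<in> {0..2 * pi}" "t \<in> {0..2 * pi}" "s < t"
  show "sweep s < sweep t"
  proof (rule DERIV_pos_imp_increasing_open[OF \<open>s < t\<close> _ continuous_on_sweep])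
    fix x assume "s < x" "x < t"
    then have "0 < sin (x / 2)"
      using \<open>s \<in> _\<close> \<open>t \<in> _\<close> by (intro sin_gt_zero) auto
    then have "0 < 1 - cos x" unfolding one_minus_cos_eq by simp
    then have "0 < sweep' x"
      unfolding sweep'_def using sqrt2_minus_cos_pos by (rule divide_pos_pos)
    then show "\<exists>y. (sweep has_real_derivative y) (at x) \<and> 0 < y" using DERIV_sweep by blast
  qed
qed

lemmas sweep_le_iff = strict_mono_on_less_eq[OF strict_mono_on_sweep]
  and sweep_less_iff = strict_mono_on_less[OF strict_mono_on_sweep]
  and sweep_eq_iff = strict_mono_on_eq[OF strict_mono_on_sweep]

lemma sweep_image: "sweep ` {0..2 * pi} = {0..2 * sweep pi}"
proof (intro antisym subsetI)
  fix y assume "y \<in> {0..2 * sweep pi}"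
  then obtain s where "0 \<le> s" "s \<le> 2 * pi" "sweep s = y"
    using IVT'[of sweep 0 y "2 * pi"] sweep_reflect[of 0] continuous_on_sweep by auto
  then show "y \<in> sweep ` {0..2 * pi}" by auto
qed (use sweep_mono[of 0] sweep_mono[of _ "2 * pi"] sweep_reflect[of 0] in auto)

subsection \<open>Deadlines\<close>

text \<open>
  For \<open>e > 0\<close>, the time \<open>q\<close> with \<open>q + dist q (cis s) = 1 + e\<close>: until then, a queen walking from the
  centre along the positive real axis can turn and still reach \<open>cis s\<close> by time \<open>1 + e\<close>.
\<close>

definition grace :: "real \<Rightarrow> real \<Rightarrow> real" where
  "grace e s = (e + e\<^sup>2 / 2) / (1 + e - cos s)"

definition grace' :: "real \<Rightarrow> real \<Rightarrow> real" where
  "grace' e s = ((1 - cos s) * (1 + e) + e\<^sup>2 / 2) / (1 + e - cos s)\<^sup>2"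

definition deadline :: "real \<Rightarrow> real \<Rightarrow> real" where
  "deadline w s = w + grace ((sqrt 2 - 1) * w) s"

lemma grace_nonneg: "0 \<le> e \<Longrightarrow> 0 \<le> grace e s"
  unfolding grace_def using cos_le_one[of s]
  by (intro divide_nonneg_nonneg) (simp, linarith)

lemma le_deadline: "0 \<le> w \<Longrightarrow> w \<le> deadline w s"
  using grace_nonneg sqrt2_bounds by (simp add: deadline_def)

lemma deadline_0 [simp]: "deadline 0 s = 0"
  by (simp add: deadline_def grace_def)

lemma deadline_reflect: "deadline w (2 * pi - s) = deadline w s"
  by (simp add: deadline_def grace_def cos_diff)

lemma add_norm_le_of_le_grace:
  assumes "0 < e" "0 \<le> q" "q \<le> grace e s"
  shows "q + norm (of_real q - cis s) \<le> 1 + e"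
proof -
  have "e \<le> 1 + e - cos s" by simp
  then have "0 < 1 + e - cos s" using \<open>0 < e\<close> by linarith
  then have q_le: "q * (1 + e - cos s) \<le> e + e\<^sup>2 / 2"
    using \<open>q \<le> grace e s\<close> unfolding grace_def by (simp only: pos_le_divide_eq)
  have "q * e \<le> q * (1 + e - cos s)"
    using \<open>0 \<le> q\<close> \<open>e \<le> 1 + e - cos s\<close> by (intro mult_left_mono)
  also note q_le
  also have "e + e\<^sup>2 / 2 = (1 + e / 2) * e" by (simp add: power2_eq_square algebra_simps)
  finally have "0 \<le> 1 + e - q" using \<open>0 < e\<close> by simp
  have "(norm (of_real q - cis s))\<^sup>2 = q\<^sup>2 - 2 * q * cos s + ((cos s)\<^sup>2 + (sin s)\<^sup>2)"
    unfolding cmod_power2 by (simp add: power2_eq_square algebra_simps)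
  also have "\<dots> \<le> (1 + e - q)\<^sup>2"
    using q_le by (simp add: power2_eq_square algebra_simps)
  finally have "norm (of_real q - cis s) \<le> 1 + e - q"
    using \<open>0 \<le> 1 + e - q\<close> by (rule power2_le_imp_le)
  then show ?thesis by simp
qed

lemma DERIV_grace:
  assumes "1 + e - cos s \<noteq> 0"
  shows "((\<lambda>e. grace e s) has_real_derivative grace' e s) (at e)"
proof -
  have "((\<lambda>e. grace e s) has_real_derivative
      ((1 + e) * (1 + e - cos s) - (e + e\<^sup>2 / 2)) / ((1 + e - cos s) * (1 + e - cos s))) (at e)"
    unfolding grace_def using assms by (auto intro!: derivative_eq_intros)
  moreover have "(1 + e) * (1 + e - cos s) - (e + e\<^sup>2 / 2) = (1 - cos s) * (1 + e) + e\<^sup>2 / 2"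
    by (simp add: power2_eq_square algebra_simps)
  ultimately show ?thesis by (simp only: grace'_def power2_eq_square[of "1 + e - cos s"])
qed

lemma grace'_nonneg: "0 \<le> e \<Longrightarrow> 0 \<le> grace' e s"
  by (simp add: grace'_def)

lemma DERIV_deadline:
  assumes "0 \<le> w" "cos s < 1"
  shows "((\<lambda>w. deadline w s) has_real_derivative
    1 + (sqrt 2 - 1) * grace' ((sqrt 2 - 1) * w) s) (at w)"
proof -
  have "0 \<le> (sqrt 2 - 1) * w" using assms sqrt2_bounds by simp
  then have "1 + (sqrt 2 - 1) * w - cos s \<noteq> 0" using assms by linarith
  from DERIV_grace[OF this] show ?thesis
    unfolding deadline_def
    by (auto intro!: derivative_eq_intros DERIV_chain2[where f = "\<lambda>e. grace e s"])
qed

lemma deadline_mono: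
  assumes "0 \<le> v" "v \<le> w" "cos s < 1"
  shows "deadline v s \<le> deadline w s"
proof (rule DERIV_nonneg_imp_nondecreasing[OF \<open>v \<le> w\<close>])
  fix t assume "v \<le> t"
  then have "0 \<le> t" using \<open>0 \<le> v\<close> by simp
  then have "0 \<le> 1 + (sqrt 2 - 1) * grace' ((sqrt 2 - 1) * t) s"
    using grace'_nonneg sqrt2_bounds by simp
  then show "\<exists>y. ((\<lambda>w. deadline w s) has_real_derivative y) (at t) \<and> 0 \<le> y"
    using DERIV_deadline[OF \<open>0 \<le> t\<close> \<open>cos s < 1\<close>] by blast
qed

lemma grace_mono_cos:
  assumes "0 \<le> e" "cos s \<le> cos t"
  shows "grace e s \<le> grace e t"
proof (cases "e = 0")
  case False
  then have "0 < 1 + e - cos t" using \<open>0 \<le> e\<close> cos_le_one[of t] by linarith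
  then show ?thesis
    unfolding grace_def using assms by (intro divide_left_mono mult_pos_pos) auto
qed (simp add: grace_def)

lemma grace_diff_le_cos_diff:
  assumes "0 \<le> e" "cos t \<le> cos s" "cos s \<le> 0"
  shows "grace e s - grace e t \<le> cos s - cos t"
proof -
  define p where "p = 1 + e - cos s"
  define q where "q = 1 + e - cos t"
  have "1 + e \<le> p" "1 + e \<le> q" using assms by (simp_all add: p_def q_def)
  then have "0 < p" "0 < q" using \<open>0 \<le> e\<close> by simp_all
  then have "grace e s - grace e t = (e + e\<^sup>2 / 2) / (p * q) * (q - p)"
    unfolding grace_def p_def[symmetric] q_def[symmetric] by (simp add: field_simps)
  also have "\<dots> \<le> 1 * (q - p)"
  proof (rule mult_right_mono)
    have "e + e\<^sup>2 / 2 \<le> (1 + e) * (1 + e)"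
      using \<open>0 \<le> e\<close> by (simp add: power2_eq_square algebra_simps)
    also have "\<dots> \<le> p * q"
      using \<open>1 + e \<le> p\<close> \<open>1 + e \<le> q\<close> \<open>0 \<le> e\<close> by (intro mult_mono) auto
    finally show "(e + e\<^sup>2 / 2) / (p * q) \<le> 1"
      using \<open>0 < p\<close> \<open>0 < q\<close> by (simp add: divide_le_eq_1)
  qed (use assms in \<open>simp add: p_def q_def\<close>)
  finally show ?thesis by (simp add: p_def q_def)
qed

lemma deadline_le_deadline_add:
  assumes "0 \<le> w" "cos s \<le> 0" "s \<le> t"
  shows "deadline w s \<le> deadline w t + (t - s)"
proof -
  define e where "e = (sqrt 2 - 1) * w"
  have "0 \<le> e" using assms sqrt2_bounds by (simp add: e_def)
  have "grace e s \<le> grace e t + (t - s)"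
  proof (cases "cos s \<le> cos t")
    case True
    then show ?thesis using grace_mono_cos[OF \<open>0 \<le> e\<close>] \<open>s \<le> t\<close> by (simp add: add_increasing2)
  next
    case False
    then show ?thesis
      using grace_diff_le_cos_diff[OF \<open>0 \<le> e\<close>, of t s] cos_diff_le_abs[of s t] assms by simp
  qed
  then show ?thesis by (simp add: deadline_def e_def)
qed

subsection \<open>Arcs away from the points \<open>1\<close> and \<open>-1\<close>\<close>

lemma sweep_le_minus_sin:
  assumes "0 \<le> s"
  shows "(sqrt 2 - 1) * sweep s \<le> s - sin s"
proof -
  define f where "f t = (t - sin t) - (sqrt 2 - 1) * sweep t" for t
  have "f 0 \<le> f s"
  proof (rule DERIV_nonneg_imp_nondecreasing[OF assms])
    fix t
    have "(f has_real_derivative (1 - cos t) - (sqrt 2 - 1) * sweep' t) (at t)"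
      unfolding f_def by (auto intro!: derivative_eq_intros)
    moreover have "(1 - cos t) - (sqrt 2 - 1) * sweep' t = (1 - cos t) * sweep' t"
      by (simp only: sweep'_lag') (simp add: sweep'_eq right_diff_distrib)
    ultimately show "\<exists>y. (f has_real_derivative y) (at t) \<and> 0 \<le> y"
      using sweep'_nonneg[of t] by (metis cos_le_one diff_ge_0_iff_ge mult_nonneg_nonneg)
  qed
  then show ?thesis by (simp add: f_def)
qed

lemma sweep_le_sin_squared_tan:
  assumes "0 \<le> h" "h < pi"
  shows "(sqrt 2 - 1) * sweep h \<le> 4 / 3 * ((sin (h / 2))\<^sup>2 * tan (h / 2))"
  using sweep_le_minus_sin[OF assms(1)] minus_sin_cos_le[of "h / 2"] sin_double[of "h / 2"] assms
  by simp

lemma seven_thirds_mult_le: "0 \<le> w \<Longrightarrow> 7 / 3 * ((sqrt 2 - 1) * w) \<le> w"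
  using mult_right_mono[of "7 / 3 * (sqrt 2 - 1)" 1 w] sqrt2_bounds
  by (simp only: mult.assoc) simp

text \<open>The numerator of \<open>grace' e h\<close> is \<open>(1 - cos h) * (1 + surplus e h)\<close>.\<close>

definition surplus :: "real \<Rightarrow> real \<Rightarrow> real" where
  "surplus e h = e + e\<^sup>2 / (4 * (sin (h / 2))\<^sup>2)"

lemma surplus_le_deadline:
  fixes h w :: real
  assumes "0 < h" "h < pi" "1 \<le> tan (h / 2)" "0 \<le> w" "w \<le> sweep h"
  shows "surplus ((sqrt 2 - 1) * w) h \<le> deadline w h"
proof -
  define e where "e = (sqrt 2 - 1) * w"
  define p where "p = (sin (h / 2))\<^sup>2"
  have "0 \<le> e" using assms sqrt2_bounds by (simp add: e_def)
  have "cos (h / 2) \<noteq> 0" using assms cos_gt_zero_pi[of "h / 2"] by simp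
  then have "p * (1 + (tan (h / 2))\<^sup>2) = (tan (h / 2))\<^sup>2"
    unfolding p_def by (rule sin_squared_mult_tan)
  moreover have "0 < 1 + (tan (h / 2))\<^sup>2" by (simp add: add_pos_nonneg)
  ultimately have "p = (tan (h / 2))\<^sup>2 / (1 + (tan (h / 2))\<^sup>2)" by (simp add: eq_divide_eq)
  then have "1 / 2 \<le> p"
    using \<open>0 < 1 + (tan (h / 2))\<^sup>2\<close> assms one_le_power[of "tan (h / 2)" 2]
    by (simp add: le_divide_eq)
  have "w \<le> 2" using sweep_mono[of h pi] sweep_pi_le_2 assms by linarith
  moreover have "7 / 3 * e \<le> w" unfolding e_def using assms by (intro seven_thirds_mult_le)
  ultimately have "e \<le> 1" by simp
  have "e\<^sup>2 / (4 * p) \<le> e\<^sup>2 / 2" using \<open>1 / 2 \<le> p\<close> by (intro divide_left_mono) auto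
  also have "\<dots> \<le> e" using mult_left_le[of e e] \<open>e \<le> _\<close> \<open>0 \<le> e\<close> by (simp add: power2_eq_square)
  finally have "e + e\<^sup>2 / (4 * p) \<le> 2 * e" by simp
  also have "\<dots> \<le> w" using \<open>7 / 3 * e \<le> w\<close> \<open>0 \<le> e\<close> by simp
  also have "\<dots> \<le> deadline w h" using assms by (intro le_deadline)
  finally show ?thesis by (simp add: surplus_def e_def p_def)
qed

lemma one_minus_two_mult_le:
  fixes a :: real
  assumes "0 < a"
  shows "1 - 2 * a \<le> 1 / (a * (2 + 4 / 3 * a))"
proof -
  have "(1 - 2 * a) * (a * (2 + 4 / 3 * a)) = 1 - ((1 - a)\<^sup>2 + 5 / 3 * a\<^sup>2 + 8 / 3 * a ^ 3)"
    by (simp add: power2_eq_square power3_eq_cube field_simps)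
  moreover have "0 \<le> (1 - a)\<^sup>2 + 5 / 3 * a\<^sup>2 + 8 / 3 * a ^ 3" using assms by simp
  ultimately have "(1 - 2 * a) * (a * (2 + 4 / 3 * a)) \<le> 1" by linarith
  then show ?thesis using assms by (simp add: le_divide_eq)
qed

lemma add_square_div_le:
  fixes a e p :: real
  assumes "0 < a" "0 < p" "p \<le> a\<^sup>2" "0 \<le> e" "e \<le> 4 / 3 * (p * a)"
  shows "e + e\<^sup>2 / (4 * p) \<le> a * (7 / 3 * e + e / (2 * p + e))"
proof -
  define u where "u = e / p"
  have "u \<le> 4 / 3 * a" using assms by (simp add: u_def divide_le_eq algebra_simps)
  have "2 * p + e = p * (2 + u)" using assms by (simp add: u_def field_simps)
  also have "\<dots> \<le> a\<^sup>2 * (2 + 4 / 3 * a)"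
    using \<open>u \<le> _\<close> assms by (intro mult_mono) (auto simp: u_def)
  finally have "a / (a\<^sup>2 * (2 + 4 / 3 * a)) \<le> a / (2 * p + e)"
    using assms by (intro divide_left_mono mult_pos_pos add_pos_nonneg) auto
  moreover have "a / (a\<^sup>2 * (2 + 4 / 3 * a)) = 1 / (a * (2 + 4 / 3 * a))"
    by (simp add: power2_eq_square)
  ultimately have "1 + u / 4 \<le> 7 / 3 * a + a / (2 * p + e)"
    using one_minus_two_mult_le[OF \<open>0 < a\<close>] \<open>u \<le> _\<close> by linarith
  from mult_left_mono[OF this \<open>0 \<le> e\<close>] show ?thesis
    by (simp add: u_def power2_eq_square algebra_simps)
qed

lemma surplus_le_tan_mult_deadline:
  fixes h w :: real
  assumes "0 < h" "h < pi" "0 \<le> w" "w \<le> sweep h"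
  shows "surplus ((sqrt 2 - 1) * w) h \<le> tan (h / 2) * deadline w h"
proof -
  define e where "e = (sqrt 2 - 1) * w"
  define p where "p = (sin (h / 2))\<^sup>2"
  define a where "a = tan (h / 2)"
  have "0 \<le> e" using assms sqrt2_bounds by (simp add: e_def)
  have "0 < p" unfolding p_def using assms sin_gt_zero[of "h / 2"] by simp
  have "0 < a" unfolding a_def using assms by (intro tan_gt_zero) auto
  have "p \<le> a\<^sup>2"
    unfolding p_def a_def using assms cos_gt_zero_pi[of "h / 2"]
    by (intro sin_squared_le_tan_squared) simp
  have "e \<le> (sqrt 2 - 1) * sweep h"
    unfolding e_def using assms sqrt2_bounds by (intro mult_left_mono) auto
  also have "\<dots> \<le> 4 / 3 * (p * a)"
    unfolding p_def a_def using assms by (intro sweep_le_sin_squared_tan) auto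
  finally have "e + e\<^sup>2 / (4 * p) \<le> a * (7 / 3 * e + e / (2 * p + e))"
    using \<open>0 < a\<close> \<open>0 < p\<close> \<open>p \<le> a\<^sup>2\<close> \<open>0 \<le> e\<close> by (intro add_square_div_le)
  also have "\<dots> \<le> a * deadline w h"
  proof -
    have denominator: "1 + e - cos h = 2 * p + e"
      using one_minus_cos_eq[of h] by (simp add: p_def)
    have "7 / 3 * e \<le> w" unfolding e_def using assms by (intro seven_thirds_mult_le)
    then show ?thesis
      unfolding deadline_def grace_def e_def[symmetric] denominator
      using \<open>0 < a\<close> \<open>0 < p\<close> \<open>0 \<le> e\<close>
      by (intro mult_left_mono add_mono divide_right_mono) auto
  qed
  finally show ?thesis by (simp add: surplus_def e_def p_def a_def)
qed

lemma surplus_le_min_tan_mult_deadline: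
  fixes h w :: real
  assumes "0 < h" "h < pi" "0 \<le> w" "w \<le> sweep h"
  shows "surplus ((sqrt 2 - 1) * w) h \<le> min (tan (h / 2)) 1 * deadline w h"
  using surplus_le_deadline[of h w] surplus_le_tan_mult_deadline[of h w] assms
  by (simp add: min_def)

lemma cos_sq_half_add_deadline_le:
  fixes h w :: real
  assumes "0 < h" "h < pi" "0 \<le> w" "w \<le> sweep h" "h + deadline w h \<le> pi"
  shows "(cos ((h + deadline w h) / 2))\<^sup>2 * (1 + surplus ((sqrt 2 - 1) * w) h)
    \<le> (cos (h / 2))\<^sup>2"
proof -
  define x where "x = deadline w h / 2"
  define d where "d = surplus ((sqrt 2 - 1) * w) h / 2"
  have "0 \<le> d" using assms(3) sqrt2_bounds by (simp add: d_def surplus_def)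
  have "0 \<le> x" using le_deadline[of w h] assms(3) by (simp add: x_def)
  have "x \<le> pi / 2 - h / 2" using assms(5) by (simp add: x_def field_simps)
  have "d \<le> min (tan (h / 2)) 1 * x"
    using surplus_le_min_tan_mult_deadline[OF assms(1-4)] by (simp add: d_def x_def)
  have "0 < cos (h / 2)" using assms(1,2) by (intro cos_gt_zero_pi) auto
  have "0 \<le> cos (h / 2 + x)"
    using assms(1,2) \<open>0 \<le> x\<close> \<open>x \<le> pi / 2 - h / 2\<close> by (intro cos_ge_zero) auto
  have "cos (h / 2 + x) \<le> (1 - min (tan (h / 2)) 1 * x) * cos (h / 2)"
    using assms(1,2) \<open>0 \<le> x\<close> \<open>x \<le> pi / 2 - h / 2\<close> by (intro cos_add_le) auto
  also have "\<dots> \<le> (1 - d) * cos (h / 2)"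
    using \<open>d \<le> _\<close> \<open>0 < cos (h / 2)\<close> by (intro mult_right_mono) auto
  finally have cos_le: "cos (h / 2 + x) \<le> (1 - d) * cos (h / 2)" .
  with \<open>0 \<le> cos (h / 2 + x)\<close> have "0 \<le> (1 - d) * cos (h / 2)" by linarith
  then have "d \<le> 1" using \<open>0 < cos (h / 2)\<close> by (simp add: zero_le_mult_iff)
  have "(cos (h / 2 + x))\<^sup>2 * (1 + 2 * d) \<le> ((1 - d) * cos (h / 2))\<^sup>2 * (1 + 2 * d)"
    using \<open>0 \<le> cos (h / 2 + x)\<close> \<open>0 \<le> d\<close> cos_le by (intro mult_right_mono power_mono) auto
  also have "\<dots> = (1 - d\<^sup>2 * (3 - 2 * d)) * (cos (h / 2))\<^sup>2"
    by (simp add: power2_eq_square algebra_simps)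
  also have "\<dots> \<le> 1 * (cos (h / 2))\<^sup>2"
    using \<open>d \<le> 1\<close> by (intro mult_right_mono) auto
  finally show ?thesis by (simp add: x_def d_def add_divide_distrib)
qed

lemma one_le_mult_grace':
  fixes h w :: real
  assumes "0 < h" "h < pi" "0 \<le> w" "w \<le> sweep h" "h + deadline w h \<le> pi"
  shows "1 \<le> (1 - cos (h + deadline w h)) * grace' ((sqrt 2 - 1) * w) h"
proof -
  define e where "e = (sqrt 2 - 1) * w"
  define p where "p = (sin (h / 2))\<^sup>2"
  define u where "u = 1 + surplus e h"
  define c where "c = (cos ((h + deadline w h) / 2))\<^sup>2"
  have "0 \<le> e" using assms sqrt2_bounds by (simp add: e_def)
  have "0 < p" unfolding p_def using assms sin_gt_zero[of "h / 2"] by simp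
  have u_eq: "u = 1 + (e + e\<^sup>2 / (4 * p))" by (simp add: u_def surplus_def p_def)
  have cos_h: "cos h = 1 - 2 * p" using one_minus_cos_eq[of h] by (simp add: p_def)
  have cos_end: "1 - cos (h + deadline w h) = 2 - 2 * c"
    unfolding one_minus_cos_eq[of "h + deadline w h"] sin_squared_eq c_def by simp
  have numerator: "(1 - cos h) * (1 + e) + e\<^sup>2 / 2 = 2 * p * u"
    using \<open>0 < p\<close> by (simp add: cos_h u_eq field_simps)
  have "c * u \<le> 1 - p"
    using cos_sq_half_add_deadline_le[OF assms]
    by (simp add: c_def e_def p_def u_def cos_squared_eq[of "h / 2"])
  then have "4 * p * (u - (1 - p)) \<le> 4 * p * (u - c * u)"
    using \<open>0 < p\<close> by (intro mult_left_mono) auto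
  moreover have "(1 + e - cos h)\<^sup>2 = 4 * p * (u - (1 - p))"
    using \<open>0 < p\<close> by (simp add: cos_h u_eq power2_eq_square field_simps)
  moreover have "4 * p * (u - c * u) = (1 - cos (h + deadline w h)) * (2 * p * u)"
    unfolding cos_end by (simp add: algebra_simps)
  ultimately have "(1 + e - cos h)\<^sup>2 \<le> (1 - cos (h + deadline w h)) * (2 * p * u)" by simp
  moreover have "0 < 1 + e - cos h" using \<open>0 < p\<close> \<open>0 \<le> e\<close> by (simp add: cos_h)
  ultimately show ?thesis
    unfolding grace'_def e_def[symmetric] numerator by (simp add: le_divide_eq)
qed

lemma one_le_sweep'_mult:
  assumes "1 \<le> (1 - cos s) * \<rho>"
  shows "1 \<le> sweep' s * (1 + (sqrt 2 - 1) * \<rho>)"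
proof -
  have "(sqrt 2 - 1) * 1 \<le> (sqrt 2 - 1) * ((1 - cos s) * \<rho>)"
    using assms sqrt2_bounds by (intro mult_left_mono) auto
  then have "sqrt 2 - cos s \<le> (1 - cos s) * (1 + (sqrt 2 - 1) * \<rho>)" by (simp add: algebra_simps)
  then show ?thesis using sqrt2_minus_cos_pos[of s] by (simp add: sweep'_def le_divide_eq)
qed

lemma sweep_add_deadline_ge:
  fixes h w :: real
  assumes "0 < h" "h < pi" "0 \<le> w" "w \<le> sweep h" "h + deadline w h \<le> pi"
  shows "sweep h + w \<le> sweep (h + deadline w h)"
proof -
  \<comment> \<open>Equality holds at \<open>w = 0\<close>, and the difference of the two sides increases with \<open>w\<close>.\<close>
  define f where "f v = sweep (h + deadline v h) - v" for v
  have "cos h < 1" using cos_monotone_0_pi[of 0 h] assms by simp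
  have "f 0 \<le> f w"
  proof (rule DERIV_nonneg_imp_nondecreasing[OF \<open>0 \<le> w\<close>])
    fix v assume "0 \<le> v" "v \<le> w"
    define \<rho> where "\<rho> = grace' ((sqrt 2 - 1) * v) h"
    have "(f has_real_derivative sweep' (h + deadline v h) * (1 + (sqrt 2 - 1) * \<rho>) - 1) (at v)"
      unfolding f_def \<rho>_def
      by (auto intro!: derivative_eq_intros DERIV_deadline[OF \<open>0 \<le> v\<close> \<open>cos h < 1\<close>])
    moreover have "h + deadline v h \<le> pi"
      using deadline_mono[OF \<open>0 \<le> v\<close> \<open>v \<le> w\<close> \<open>cos h < 1\<close>] assms by simp
    then have "1 \<le> sweep' (h + deadline v h) * (1 + (sqrt 2 - 1) * \<rho>)"
      unfolding \<rho>_def using assms \<open>0 \<le> v\<close> \<open>v \<le> w\<close>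
      by (intro one_le_sweep'_mult one_le_mult_grace') auto
    ultimately show "\<exists>y. (f has_real_derivative y) (at v) \<and> 0 \<le> y" by fastforce
  qed
  then show ?thesis by (simp add: f_def)
qed

lemma intermediate_arc_le_deadline:
  assumes "0 < s" "s \<le> b" "b \<le> pi" "0 \<le> w" "w \<le> sweep s" "sweep b \<le> sweep s + w"
  shows "b - s \<le> deadline w s"
proof (rule ccontr)
  assume "\<not> b - s \<le> deadline w s"
  then have "s + deadline w s < b" by simp
  moreover have "0 \<le> deadline w s" using le_deadline[of w s] assms by simp
  ultimately have "sweep (s + deadline w s) < sweep b"
    using assms pi_gt_zero by (subst sweep_less_iff) auto
  moreover have "sweep s + w \<le> sweep (s + deadline w s)"
    using assms \<open>s + deadline w s < b\<close> \<open>0 \<le> deadline w s\<close> by (intro sweep_add_deadline_ge) auto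
  ultimately show False using assms by simp
qed

subsection \<open>The arc starting at the point \<open>1\<close>\<close>

lemma lag_minus_sin_lag_le:
  assumes "0 \<le> b" "b \<le> pi"
  shows "lag b - sin (lag b) \<le> (sqrt 2 - 1) * sweep b"
proof -
  define f where "f s = (sqrt 2 - 1) * sweep s - (lag s - sin (lag s))" for s
  have "f 0 \<le> f b"
  proof (rule DERIV_nonneg_imp_nondecreasing[OF assms(1)])
    fix s assume "0 \<le> s" "s \<le> b"
    have "(f has_real_derivative (sqrt 2 - 1) * sweep' s - (lag' s - cos (lag s) * lag' s)) (at s)"
      unfolding f_def by (auto intro!: derivative_eq_intros)
    then have "(f has_real_derivative (cos (lag s) - cos s) * lag' s) (at s)"
      unfolding sweep'_lag' by (simp add: algebra_simps)
    moreover have "cos s \<le> cos (lag s)"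
      using lag_mono[OF \<open>0 \<le> s\<close>] sweep_mono[OF \<open>0 \<le> s\<close>] \<open>s \<le> b\<close> assms
      by (intro cos_monotone_0_pi_le) (auto simp: sweep_def)
    ultimately show "\<exists>y. (f has_real_derivative y) (at s) \<and> 0 \<le> y"
      using lag'_pos[of s] by (metis diff_ge_0_iff_ge less_imp_le mult_nonneg_nonneg)
  qed
  then show ?thesis by (simp add: f_def)
qed

lemma two_mult_lag_minus_one_le:
  assumes "b \<le> pi"
  shows "2 * (lag b - 1) \<le> (sqrt 2 - 1) * sweep b"
proof -
  define f where "f s = (sqrt 2 - 1) * sweep s - 2 * lag s" for s
  have "f pi \<le> f b"
  proof (rule DERIV_nonpos_imp_nonincreasing[OF assms])
    fix s
    have "(f has_real_derivative (sqrt 2 - 1) * sweep' s - 2 * lag' s) (at s)"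
      unfolding f_def by (auto intro!: derivative_eq_intros)
    then have "(f has_real_derivative - ((1 + cos s) * lag' s)) (at s)"
      unfolding sweep'_lag' by (simp add: algebra_simps)
    moreover have "0 \<le> 1 + cos s" using cos_ge_minus_one[of s] by linarith
    ultimately show "\<exists>y. (f has_real_derivative y) (at s) \<and> y \<le> 0"
      using lag'_pos[of s] by (intro exI conjI) auto
  qed
  moreover have "f pi = - sweep pi"
    by (simp add: f_def sweep_pi lag_pi algebra_simps)
  ultimately show ?thesis using sweep_pi_le_2 by (simp add: f_def)
qed

lemma diff_mult_le_of_cube_le:
  fixes s v e :: real
  assumes "0 \<le> s" "s \<le> v" "v ^ 3 \<le> 8 * e" "2 * (v - 1) \<le> e"
  shows "(v - s) * (2 * e + s\<^sup>2) \<le> 2 * e + e\<^sup>2"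
proof -
  have "0 \<le> e" using zero_le_power[of v 3] assms by linarith
  have "(v - s) * s \<le> v\<^sup>2 / 4"
    using zero_le_power2[of "v / 2 - s"] by (simp add: power2_eq_square field_simps)
  have "(v - s) * s\<^sup>2 = (v - s) * s * s" by (simp add: power2_eq_square)
  also have "\<dots> \<le> v\<^sup>2 / 4 * s" using \<open>(v - s) * s \<le> v\<^sup>2 / 4\<close> assms by (intro mult_right_mono)
  also have "\<dots> \<le> 2 * e * (1 - v + s) + e\<^sup>2"
  proof (cases "v \<le> 1")
    case True
    have "0 \<le> (1 - v) * (v - s)" using True assms by simp
    then have "v\<^sup>2 / 4 * s \<le> v\<^sup>2 / 4 * (v * (1 - v + s))"
      by (intro mult_left_mono) (simp_all add: algebra_simps)
    also have "\<dots> = v ^ 3 / 4 * (1 - v + s)" by (simp add: power2_eq_square power3_eq_cube)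
    also have "\<dots> \<le> 2 * e * (1 - v + s)" using True assms by (intro mult_right_mono) auto
    finally show ?thesis using zero_le_power2[of e] by linarith
  next
    case False
    then have "v\<^sup>2 \<le> v ^ 3" by (intro power_increasing) auto
    then have "v\<^sup>2 / 4 * s \<le> 2 * e * s" using assms by (intro mult_right_mono) auto
    moreover have "0 \<le> e * (e - 2 * (v - 1))" using \<open>0 \<le> e\<close> assms by simp
    ultimately show ?thesis by (simp add: power2_eq_square algebra_simps)
  qed
  finally show ?thesis by (simp add: algebra_simps)
qed

lemma initial_arc_le_deadline:
  assumes "0 \<le> s" "s \<le> b" "b \<le> pi"
  shows "b - s \<le> deadline (sweep b) s"
proof -
  define e where "e = (sqrt 2 - 1) * sweep b"
  have "lag b - s \<le> grace e s"
  proof (cases "s < lag b")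
    case True
    have "b \<noteq> 0" using True assms by auto
    then have "sweep 0 < sweep b" using assms pi_gt_zero by (subst sweep_less_iff) auto
    then have "0 < e" using sqrt2_bounds by (simp add: e_def)
    have "(sqrt 2 - 1) * pi \<le> 1 / 2 * 4"
      using sqrt2_bounds pi_less_4 by (intro mult_mono) auto
    then have "lag b \<le> 2" using lag_mono[OF assms(3)] by (simp add: lag_pi)
    then have "lag b ^ 3 \<le> 8 * e"
      using cube_le_minus_sin[of "lag b"] lag_minus_sin_lag_le[of b] True assms
      by (simp add: e_def)
    have "2 * ((lag b - s) * (1 + e - cos s)) = (lag b - s) * (2 * (1 + e - cos s))" by simp
    also have "\<dots> \<le> (lag b - s) * (2 * e + s\<^sup>2)"
      using True one_minus_cos_le[of s] by (intro mult_left_mono) auto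
    also have "\<dots> \<le> 2 * e + e\<^sup>2"
      using \<open>lag b ^ 3 \<le> 8 * e\<close> two_mult_lag_minus_one_le[OF assms(3)] True assms
      by (intro diff_mult_le_of_cube_le) (simp_all add: e_def)
    finally have "(lag b - s) * (1 + e - cos s) \<le> e + e\<^sup>2 / 2" by simp
    moreover have "0 < 1 + e - cos s" using \<open>0 < e\<close> cos_le_one[of s] by linarith
    ultimately show ?thesis unfolding grace_def by (simp only: pos_le_divide_eq)
  next
    case False
    have "0 \<le> e" using sweep_mono[of 0 b] assms sqrt2_bounds by (simp add: e_def)
    then show ?thesis using False grace_nonneg[of e s] by linarith
  qed
  then show ?thesis by (simp add: deadline_def e_def sweep_def)
qed

subsection \<open>The arc around the point \<open>-1\<close>\<close>

lemma mult_lag_diff_le_sweep_diff: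
  assumes "0 \<le> s" "s \<le> pi"
  shows "(1 - cos s) * (lag pi - lag s) \<le> (sqrt 2 - 1) * (sweep pi - sweep s)"
proof -
  define f where "f t = (sqrt 2 - 1) * (sweep pi - sweep t) - (1 - cos t) * (lag pi - lag t)" for t
  have "f pi \<le> f s"
  proof (rule DERIV_nonpos_imp_nonincreasing[OF assms(2)])
    fix t assume "s \<le> t" "t \<le> pi"
    have "(f has_real_derivative (1 - cos t) * lag' t - (sqrt 2 - 1) * sweep' t
        - sin t * (lag pi - lag t)) (at t)"
      unfolding f_def by (auto intro!: derivative_eq_intros)
    then have "(f has_real_derivative - (sin t * (lag pi - lag t))) (at t)"
      by (simp add: sweep'_lag')
    moreover have "0 \<le> sin t * (lag pi - lag t)"
      using lag_mono[OF \<open>t \<le> pi\<close>] \<open>s \<le> t\<close> \<open>t \<le> pi\<close> assms by (simp add: sin_ge_zero)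
    ultimately show "\<exists>y. (f has_real_derivative y) (at t) \<and> y \<le> 0" by auto
  qed
  then show ?thesis by (simp add: f_def)
qed

lemma two_mult_lag'_le_1: "cos s \<le> 0 \<Longrightarrow> 2 * lag' s \<le> 1"
  unfolding lag'_def using sqrt2_minus_cos_pos[of s] sqrt2_bounds by (simp add: divide_le_eq)

lemma lag_diff_mult_le:
  fixes s :: real
  assumes "pi / 2 \<le> s" "s \<le> pi"
  defines "x \<equiv> (sqrt 2 - 1) * (sweep pi - sweep s)"
  shows "(lag pi - lag s) * (1 - cos s + 2 * x) \<le> x * (1 + x)"
proof -
  define S where "S t = (sqrt 2 - 1) * (sweep pi - sweep t)" for t
  define L where "L t = lag pi - lag t" for t
  define f where "f t = S t * (1 + S t) - L t * (1 - cos t + 2 * S t)" for t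
  have "f pi \<le> f s"
  proof (rule DERIV_nonpos_imp_nonincreasing[OF assms(2)])
    fix t assume "s \<le> t" "t \<le> pi"
    define q where "q = 1 - cos t"
    have "pi / 2 \<le> t" "0 \<le> t" using \<open>s \<le> t\<close> assms pi_gt_zero by linarith+
    have "cos t \<le> 0" using cos_monotone_0_pi_le[of "pi / 2" t] \<open>pi / 2 \<le> t\<close> \<open>t \<le> pi\<close> by simp
    have "0 \<le> sin t" using \<open>0 \<le> t\<close> \<open>t \<le> pi\<close> by (rule sin_ge_zero)
    have "0 \<le> L t" using lag_mono[OF \<open>t \<le> pi\<close>] by (simp add: L_def)
    have "q * L t \<le> S t"
      unfolding q_def L_def S_def using \<open>0 \<le> t\<close> \<open>t \<le> pi\<close> by (rule mult_lag_diff_le_sweep_diff)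
    have "(S has_real_derivative - (q * lag' t)) (at t)"
      unfolding S_def q_def sweep'_lag'[symmetric] by (auto intro!: derivative_eq_intros)
    moreover have "(L has_real_derivative - lag' t) (at t)"
      unfolding L_def by (auto intro!: derivative_eq_intros)
    ultimately have "(f has_real_derivative - (q * lag' t) * (1 + S t) + (- (q * lag' t)) * S t
        - (- lag' t * (q + 2 * S t) + (sin t + 2 * - (q * lag' t)) * L t)) (at t)"
      (is "(f has_real_derivative ?D) _")
      unfolding f_def q_def by (auto intro!: derivative_eq_intros)
    moreover have "q * (2 - q) = (sin t)\<^sup>2"
      by (simp add: q_def sin_squared_eq power2_eq_square algebra_simps)
    then have "?D = 2 * lag' t * (q - 1) * (q * L t - S t) - L t * sin t * (1 - 2 * lag' t * sin t)"
      by algebra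
    moreover have "2 * lag' t * (q - 1) * (q * L t - S t) \<le> 0"
      using \<open>cos t \<le> 0\<close> \<open>q * L t \<le> S t\<close> lag'_pos[of t]
      by (intro mult_nonneg_nonpos mult_nonneg_nonneg) (simp_all add: q_def)
    moreover have "0 \<le> L t * sin t * (1 - 2 * lag' t * sin t)"
      using \<open>0 \<le> sin t\<close> \<open>0 \<le> L t\<close> mult_mono[of "2 * lag' t" 1 "sin t" 1]
        two_mult_lag'_le_1[OF \<open>cos t \<le> 0\<close>] by simp
    ultimately show "\<exists>y. (f has_real_derivative y) (at t) \<and> y \<le> 0" by force
  qed
  then show ?thesis by (simp add: f_def S_def L_def x_def)
qed

lemma antipodal_half_arc_le_deadline:
  assumes "pi / 2 \<le> a" "a \<le> pi" "w = 2 * (sweep pi - sweep a)"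
  shows "2 * (pi - a) \<le> deadline w a"
proof -
  define x where "x = (sqrt 2 - 1) * (sweep pi - sweep a)"
  have "cos a \<le> 0" using cos_monotone_0_pi_le[of "pi / 2" a] assms by simp
  have "0 \<le> x" using sweep_mono[OF assms(2)] sqrt2_bounds by (simp add: x_def)
  then have "0 < 1 - cos a + 2 * x" using \<open>cos a \<le> 0\<close> by simp
  moreover have "(lag pi - lag a) * (1 - cos a + 2 * x) \<le> x * (1 + x)"
    unfolding x_def using assms by (intro lag_diff_mult_le)
  ultimately have "lag pi - lag a \<le> x * (1 + x) / (1 - cos a + 2 * x)"
    by (simp only: pos_le_divide_eq)
  moreover have "(sqrt 2 - 1) * w = 2 * x" by (simp add: assms x_def)
  moreover have "grace (2 * x) a = 2 * (x * (1 + x) / (1 - cos a + 2 * x))"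
    by (simp add: grace_def power2_eq_square algebra_simps)
  ultimately have "2 * (lag pi - lag a) \<le> grace ((sqrt 2 - 1) * w) a" by simp
  then show ?thesis by (simp add: deadline_def assms sweep_def)
qed

lemma antipodal_arc_le_deadline:
  assumes "pi / 2 \<le> a" "a \<le> pi" "w = 2 * (sweep pi - sweep a)" "a \<le> s"
  shows "2 * pi - a - s \<le> deadline w s"
proof -
  have "0 \<le> w" using sweep_mono[OF assms(2)] by (simp add: assms)
  moreover have "cos a \<le> 0" using cos_monotone_0_pi_le[of "pi / 2" a] assms by simp
  ultimately have "deadline w a \<le> deadline w s + (s - a)"
    using \<open>a \<le> s\<close> by (rule deadline_le_deadline_add)
  then show ?thesis using antipodal_half_arc_le_deadline[OF assms(1-3)] by simp
qed

lemma two_sweep_half_pi_le: "2 * sweep (pi / 2) \<le> sweep pi"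
proof -
  have "0 \<le> arctan (sqrt 2 - 1)" using sqrt2_bounds by simp
  then have "0 \<le> (sqrt 2 - 1) * (4 * arctan (sqrt 2 - 1))" using sqrt2_bounds by simp
  then show ?thesis by (simp add: sweep_def lag_def algebra_simps)
qed

subsection \<open>Trajectories and arrival times\<close>

definition queen_path :: "real \<Rightarrow> real \<Rightarrow> complex" where
  "queen_path w t = of_real (max 0 (t - 1 - w))"

definition servant_path :: "real \<Rightarrow> real \<Rightarrow> real \<Rightarrow> complex" where
  "servant_path \<sigma> a t = of_real (min t 1) * cis (a + \<sigma> * max 0 (t - 1))"

lemma norm_cis_diff_le: "norm (cis a - cis b) \<le> \<bar>a - b\<bar>"
proof -
  have "cis a - cis b = cis b * (exp (\<i> * of_real (a - b)) - 1)"
    by (simp add: cis_conv_exp exp_add[symmetric] algebra_simps)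
  then have "norm (cis a - cis b) = 2 * \<bar>sin ((a - b) / 2)\<bar>"
    by (simp add: norm_mult dist_exp_i_1 del: of_real_diff)
  also have "\<dots> \<le> 2 * \<bar>(a - b) / 2\<bar>" by (intro mult_left_mono abs_sin_x_le_abs_x) simp
  finally show ?thesis by simp
qed

lemma lipschitz_queen_path: "1-lipschitz_on S (queen_path w)"
proof (rule lipschitz_onI)
  fix s t
  have "dist (queen_path w s) (queen_path w t) = \<bar>max 0 (s - 1 - w) - max 0 (t - 1 - w)\<bar>"
    unfolding queen_path_def dist_norm by (simp flip: of_real_diff)
  then show "dist (queen_path w s) (queen_path w t) \<le> 1 * dist s t"
    by (simp add: dist_real_def)
qed simp

lemma lipschitz_servant_path:
  assumes "\<bar>\<sigma>\<bar> \<le> 1"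
  shows "1-lipschitz_on {0..} (servant_path \<sigma> a)"
proof (rule lipschitz_on_leI)
  fix s t :: real assume "s \<in> {0..}" "t \<in> {0..}" "s \<le> t"
  let ?m = "\<lambda>t. min t (1::real)" and ?M = "\<lambda>t. max 0 (t - (1::real))"
  have "dist (servant_path \<sigma> a s) (servant_path \<sigma> a t)
      = norm (of_real (?m s) * (cis (a + \<sigma> * ?M s) - cis (a + \<sigma> * ?M t))
          + of_real (?m s - ?m t) * cis (a + \<sigma> * ?M t))"
    unfolding dist_norm servant_path_def by (simp add: algebra_simps)
  also have "\<dots> \<le> \<bar>?m s\<bar> * norm (cis (a + \<sigma> * ?M s) - cis (a + \<sigma> * ?M t)) + \<bar>?m s - ?m t\<bar>"
    by (rule order_trans[OF norm_triangle_ineq]) (simp add: norm_mult del: of_real_diff)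
  also have "\<dots> \<le> \<bar>?m s\<bar> * \<bar>(a + \<sigma> * ?M s) - (a + \<sigma> * ?M t)\<bar> + \<bar>?m s - ?m t\<bar>"
    by (intro add_right_mono mult_left_mono norm_cis_diff_le) auto
  also have "\<dots> = \<bar>?m s\<bar> * (\<bar>\<sigma>\<bar> * \<bar>?M s - ?M t\<bar>) + \<bar>?m s - ?m t\<bar>"
    by (simp flip: abs_mult add: right_diff_distrib)
  also have "\<dots> \<le> 1 * (1 * \<bar>?M s - ?M t\<bar>) + \<bar>?m s - ?m t\<bar>"
    using \<open>s \<in> _\<close> \<open>t \<in> _\<close> assms by (intro add_right_mono mult_mono) auto
  also have "\<dots> = t - s" using \<open>s \<in> _\<close> \<open>t \<in> _\<close> \<open>s \<le> t\<close> by auto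
  finally show "dist (servant_path \<sigma> a s) (servant_path \<sigma> a t) \<le> 1 * dist s t"
    using \<open>s \<le> t\<close> by (simp add: dist_real_def)
qed simp

lemma queen_path_arrival_le:
  assumes "0 < e" "0 \<le> w" "t \<le> w + grace e s"
  shows "(1 + t) + dist (queen_path w (1 + t)) (cis s) \<le> 2 + w + e"
proof (cases "t \<le> w")
  case True
  then show ?thesis using \<open>0 < e\<close> by (simp add: queen_path_def)
next
  case False
  then have "queen_path w (1 + t) = of_real (t - w)" by (simp add: queen_path_def)
  then show ?thesis
    using add_norm_le_of_le_grace[of e "t - w" s] False assms by (simp add: dist_norm)
qed

lemma queen_arrival_time_le:
  assumes "valid_algorithm n A" "r \<in> robots n" "0 \<le> t" "A r t = x"
  shows "queen_arrival_time n A x \<le> t + dist (A Queen t) x"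
proof -
  define d where "d = discovery_time n A x"
  have "0 \<le> d" "d \<le> t"
    using assms unfolding d_def discovery_time_def
    by (auto intro!: cInf_greatest cInf_lower bdd_belowI[of _ 0])
  have "1-lipschitz_on {0..} (A Queen)" using assms by (simp add: valid_algorithm_def robots_def)
  then have "dist (A Queen d) (A Queen t) \<le> t - d"
    using lipschitz_onD[of 1 "{0..}" "A Queen" d t] \<open>0 \<le> d\<close> \<open>d \<le> t\<close> by (simp add: dist_real_def)
  then have "d + dist (A Queen d) x \<le> t + dist (A Queen t) x"
    using dist_triangle[of "A Queen d" x "A Queen t"] by linarith
  then show ?thesis by (simp add: queen_arrival_time_def d_def)
qed

lemma solves_PE_evacuation_time_le:
  assumes valid: "valid_algorithm n A"
    and visit: "\<And>x. x \<in> sphere 0 1 \<Longrightarrow>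
      \<exists>r\<in>robots n. \<exists>t\<ge>0. A r t = x \<and> t + dist (A Queen t) x \<le> T"
  shows "solves_PE n A \<and> evacuation_time n A \<le> ereal T"
proof
  have "\<exists>r\<in>robots n. \<exists>t\<in>{0..T}. A r t = x" if "x \<in> sphere 0 1" for x
  proof -
    obtain r t where "r \<in> robots n" "0 \<le> t" "A r t = x" "t + dist (A Queen t) x \<le> T"
      using visit[OF \<open>x \<in> sphere 0 1\<close>] by blast
    moreover from this have "t \<le> T" using zero_le_dist[of "A Queen t" x] by linarith
    ultimately show ?thesis by (metis atLeastAtMost_iff)
  qed
  moreover from this[of 1] have "0 \<le> T" by auto
  ultimately show "solves_PE n A" using valid by (auto simp: solves_PE_def)
  show "evacuation_time n A \<le> ereal T"
    unfolding evacuation_time_def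
  proof (rule SUP_least)
    fix x :: complex assume "x \<in> sphere 0 1"
    then obtain r t where "r \<in> robots n" "0 \<le> t" "A r t = x" "t + dist (A Queen t) x \<le> T"
      using visit by blast
    with queen_arrival_time_le[OF valid] show "ereal (queen_arrival_time n A x) \<le> ereal T" by force
  qed
qed

subsection \<open>The partition of the circle\<close>

locale circle_partition =
  fixes n :: nat
  assumes two_le_n: "2 \<le> n"
begin

definition wait :: real where
  "wait = 2 * sweep pi / real n"

definition cut :: "nat \<Rightarrow> real" where
  "cut k = inv_into {0..2 * pi} sweep (real k * wait)"

lemma n_mult_wait: "real n * wait = 2 * sweep pi"
  using two_le_n by (simp add: wait_def)

lemma wait_pos: "0 < wait"
  using two_le_n sqrt2_bounds by (simp add: wait_def sweep_pi)

lemma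
  assumes "k \<le> n"
  shows cut_in: "cut k \<in> {0..2 * pi}" and sweep_cut: "sweep (cut k) = real k * wait"
proof -
  have "real k * wait \<le> real n * wait" using assms wait_pos by (intro mult_right_mono) auto
  then have "real k * wait \<in> sweep ` {0..2 * pi}"
    unfolding sweep_image n_mult_wait using wait_pos by simp
  then show "cut k \<in> {0..2 * pi}" "sweep (cut k) = real k * wait"
    unfolding cut_def by (rule inv_into_into, rule f_inv_into_f)
qed

lemma cut_eq_iff:
  assumes "k \<le> n" "s \<in> {0..2 * pi}"
  shows "cut k = s \<longleftrightarrow> real k * wait = sweep s"
  using sweep_eq_iff[OF cut_in assms(2)] sweep_cut assms by simp

lemma cut_0: "cut 0 = 0"
  by (subst cut_eq_iff) simp_all

lemma cut_mono:
  assumes "j \<le> k" "k \<le> n"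
  shows "cut j \<le> cut k"
proof -
  have "sweep (cut j) \<le> sweep (cut k)"
    using assms wait_pos by (simp add: sweep_cut mult_right_mono)
  then show ?thesis using sweep_le_iff[OF cut_in cut_in] assms by simp
qed

lemma cut_reflect:
  assumes "k \<le> n"
  shows "cut (n - k) = 2 * pi - cut k"
proof (subst cut_eq_iff)
  show "2 * pi - cut k \<in> {0..2 * pi}" using cut_in[OF assms] by simp
  show "real (n - k) * wait = sweep (2 * pi - cut k)"
    unfolding sweep_reflect using assms n_mult_wait
    by (simp add: sweep_cut of_nat_diff left_diff_distrib)
qed simp

lemma cut_le_pi: "2 * k \<le> n \<Longrightarrow> cut k \<le> pi"
  using cut_mono[of k "n - k"] cut_reflect[of k] by simp

lemma initial_arc_in_time:
  assumes "s \<in> {cut 0..cut 1}"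
  shows "cut 1 - s \<le> deadline wait s"
  using initial_arc_le_deadline[of s "cut 1"] cut_le_pi[of 1] sweep_cut[of 1] cut_0 two_le_n assms
  by simp

lemma intermediate_arc_in_time:
  assumes "0 < j" "2 * Suc j \<le> n" "s \<in> {cut j..cut (Suc j)}"
  shows "cut (Suc j) - s \<le> deadline wait s"
proof (rule intermediate_arc_le_deadline)
  have "1 * wait \<le> real j * wait" using assms wait_pos by (intro mult_right_mono) auto
  moreover have "real j * wait \<le> sweep s"
    using sweep_mono[of "cut j" s] sweep_cut[of j] assms by simp
  ultimately show "wait \<le> sweep s" by simp
  show "sweep (cut (Suc j)) \<le> sweep s + wait"
    using \<open>real j * wait \<le> sweep s\<close> sweep_cut[of "Suc j"] assms by (simp add: algebra_simps)
  show "0 < s"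
    using \<open>wait \<le> sweep s\<close> wait_pos cut_in[of j] assms by (cases "s = 0") auto
qed (use assms wait_pos cut_le_pi[of "Suc j"] in auto)

lemma antipodal_arc_in_time:
  assumes "Suc (2 * j) = n" "s \<in> {cut j..cut (Suc j)}"
  shows "cut (Suc j) - s \<le> deadline wait s"
proof -
  have "j \<le> n" "Suc j = n - j" "1 \<le> j" using assms(1) two_le_n by auto
  have total: "(2 * real j + 1) * wait = 2 * sweep pi"
    using n_mult_wait assms(1) by (metis of_nat_Suc of_nat_mult of_nat_numeral add.commute)
  have "1 * wait \<le> real j * wait" using \<open>1 \<le> j\<close> wait_pos by (intro mult_right_mono) auto
  then have "sweep (pi / 2) \<le> sweep (cut j)"
    using total two_sweep_half_pi_le wait_pos unfolding sweep_cut[OF \<open>j \<le> n\<close>] distrib_right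
    by linarith
  then have "pi / 2 \<le> cut j" using sweep_le_iff[OF _ cut_in[OF \<open>j \<le> n\<close>]] by simp
  moreover have "cut j \<le> pi" using assms(1) by (intro cut_le_pi) simp
  moreover have "wait = 2 * (sweep pi - sweep (cut j))"
    using total by (simp add: sweep_cut[OF \<open>j \<le> n\<close>] algebra_simps)
  ultimately have "2 * pi - cut j - s \<le> deadline wait s"
    using assms(2) by (intro antipodal_arc_le_deadline) auto
  then show ?thesis unfolding \<open>Suc j = n - j\<close> cut_reflect[OF \<open>j \<le> n\<close>] .
qed

lemma upper_arc_in_time:
  assumes "2 * j < n" "s \<in> {cut j..cut (Suc j)}"
  shows "cut (Suc j) - s \<le> deadline wait s"
proof -
  consider "j = 0" | "0 < j" "2 * Suc j \<le> n" | "Suc (2 * j) = n"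
    using assms(1) by atomize_elim arith
  then show ?thesis
    using assms initial_arc_in_time intermediate_arc_in_time antipodal_arc_in_time
    by cases auto
qed

lemma lower_arc_in_time:
  assumes "j < n" "n \<le> 2 * j" "s \<in> {cut j..cut (Suc j)}"
  shows "s - cut j \<le> deadline wait s"
proof -
  have "cut (Suc (n - Suc j)) = 2 * pi - cut j" "cut (n - Suc j) = 2 * pi - cut (Suc j)"
    using assms cut_reflect[of j] cut_reflect[of "Suc j"] by (simp_all add: Suc_diff_Suc)
  then show ?thesis
    using upper_arc_in_time[of "n - Suc j" "2 * pi - s"] assms by (simp add: deadline_reflect)
qed

lemma arc_containing:
  assumes "s \<in> {0..2 * pi}"
  obtains j where "j < n" "s \<in> {cut j..cut (Suc j)}"
proof (cases "s \<le> cut 0")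
  case True
  then show ?thesis using that[of 0] assms cut_0 cut_in[of 1] two_le_n by simp
next
  case False
  moreover have "s \<le> cut n" using assms cut_reflect[of 0] cut_0 by simp
  ultimately obtain j where "j < n" "\<not> s \<le> cut j" "s \<le> cut (Suc j)"
    using ex_least_nat_less[of "\<lambda>k. s \<le> cut k" n] by blast
  then show ?thesis using that[of j] by simp
qed

definition trajectory :: algorithm where
  "trajectory r = (case r of
      Queen \<Rightarrow> queen_path wait
    | Servant k \<Rightarrow>
        if 2 * k \<le> n + 1 then servant_path (- 1) (cut k) else servant_path 1 (cut (k - 1)))"

lemma valid_trajectory: "valid_algorithm n trajectory"
proof -
  have "queen_path wait 0 = 0" "servant_path \<sigma> a 0 = 0" for \<sigma> a
    using wait_pos by (simp_all add: queen_path_def servant_path_def)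
  then have "trajectory r 0 = 0 \<and> 1-lipschitz_on {0..} (trajectory r)" for r
    by (cases r) (simp_all add: trajectory_def lipschitz_queen_path lipschitz_servant_path)
  then show ?thesis by (simp add: valid_algorithm_def)
qed

lemma servant_visits:
  assumes "j < n" "s \<in> {cut j..cut (Suc j)}"
  obtains t where "0 \<le> t" "t \<le> deadline wait s" "trajectory (Servant (Suc j)) (1 + t) = cis s"
proof (cases "2 * j < n")
  case True
  then show ?thesis
    using assms upper_arc_in_time[OF True assms(2)]
    by (intro that[of "cut (Suc j) - s"]) (simp_all add: trajectory_def servant_path_def)
next
  case False
  then show ?thesis
    using assms lower_arc_in_time[of j s]
    by (intro that[of "s - cut j"]) (simp_all add: trajectory_def servant_path_def)
qed

lemma trajectory_visits:
  assumes "x \<in> sphere 0 1"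
  shows "\<exists>r\<in>robots n. \<exists>t\<ge>0. trajectory r t = x \<and>
    t + dist (trajectory Queen t) x \<le> 2 + sqrt 2 * wait"
proof -
  have x_eq: "x = cis (Arg2pi x)"
    using Arg2pi_eq[of x] assms by (simp add: cis_conv_exp)
  have "Arg2pi x \<in> {0..2 * pi}" using Arg2pi[of x] by simp
  then obtain j where "j < n" "Arg2pi x \<in> {cut j..cut (Suc j)}" by (rule arc_containing)
  then obtain t where "0 \<le> t" "t \<le> deadline wait (Arg2pi x)"
      and visits: "trajectory (Servant (Suc j)) (1 + t) = cis (Arg2pi x)"
    by (rule servant_visits)
  have "(1 + t) + dist (queen_path wait (1 + t)) (cis (Arg2pi x)) \<le> 2 + wait + (sqrt 2 - 1) * wait"
    using \<open>t \<le> _\<close> wait_pos sqrt2_bounds by (intro queen_path_arrival_le) (auto simp: deadline_def)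
  then have "(1 + t) + dist (trajectory Queen (1 + t)) x \<le> 2 + sqrt 2 * wait"
    using x_eq by (simp add: trajectory_def algebra_simps)
  moreover have "Servant (Suc j) \<in> robots n" using \<open>j < n\<close> by (simp add: robots_def)
  ultimately show ?thesis using \<open>0 \<le> t\<close> visits x_eq by (metis add_nonneg_nonneg zero_le_one)
qed

end

theorem theorem1:
  fixes n :: nat
  assumes "n \<ge> 4"
  shows "\<exists>A. solves_PE n A \<and> evacuation_time n A \<le> ereal (2 + 4 * (sqrt 2 - 1) * (pi / real n))"
proof -
  interpret circle_partition n using assms by unfold_locales simp
  have "sqrt 2 * wait = 4 * (sqrt 2 - 1) * (pi / real n)"
    by (simp add: wait_def sweep_pi algebra_simps diff_divide_distrib)
  then show ?thesis
    using solves_PE_evacuation_time_le[OF valid_trajectory trajectory_visits] by auto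
qed

end
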